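(* Let $\mathbb{Z}_2^n$ denote the elementary abelian group $(\{0,1\}^n, +)$ with componentwise addition modulo 2, and let $F_n = \mathbb{Z}_2^n \setminus \{0\}$. For any integer $n \geq 2$, there exists a permutation $(v_1, v_2, \ldots, v_{2^n-1})$ of $F_n$ such that $v_{i-1} + v_i + v_{i+1} = 0$ for every $i \in \{2, 4, \ldots, 2^n - 2\}$ if and only if $n \notin \{3, 4\}$.
   Context: Such a permutation is called ternary, and $\mathbb{Z}_2^n$ is called sequentially ternary when a ternary permutation of $F_n$ exists. Equivalently, for a set $X$ with $|X| = n$, this asks for an ordering $(A_1, \ldots, A_{2^n-1})$ of all nonempty subsets of $X$ with $A_{j-1} \triangle A_j \triangle A_{j+1} = \emptyset$ for each even $j < 2^n - 1$. *)

theory Defs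
  imports "HOL-Algebra.Product_Groups" "HOL-Algebra.Elementary_Groups"
begin

definition Z2_power :: "nat \<Rightarrow> (nat \<Rightarrow> int) monoid" where
  "Z2_power n = product_group {..<n} (\<lambda>_. integer_mod_group 2)"

definition nonzero_vectors :: "nat \<Rightarrow> (nat \<Rightarrow> int) set" where
  "nonzero_vectors n = carrier (Z2_power n) - {\<one>\<^bsub>Z2_power n\<^esub>}"

(* A permutation (v_1, ..., v_{2^n-1}) of F_n is an enumeration of F_n without repetition,
   i.e. a bijection from {1..2^n-1} onto F_n; values of v at other indices are irrelevant. *)
definition ternary_permutation :: "nat \<Rightarrow> (nat \<Rightarrow> nat \<Rightarrow> int) \<Rightarrow> bool" where
  "ternary_permutation n v \<longleftrightarrow>
     bij_betw v {1..2 ^ n - 1} (nonzero_vectors n) \<and>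
     (\<forall>i\<in>{2..2 ^ n - 2}. even i \<longrightarrow>
        v (i - 1) \<otimes>\<^bsub>Z2_power n\<^esub> v i \<otimes>\<^bsub>Z2_power n\<^esub> v (i + 1) = \<one>\<^bsub>Z2_power n\<^esub>)"

definition sequentially_ternary :: "nat \<Rightarrow> bool" where
  "sequentially_ternary n \<longleftrightarrow> (\<exists>v. ternary_permutation n v)"

end

(*
Encode Z_2^n as {0, ..., 2^n - 1} with bitwise xor. A ternary permutation is then a chain of lines
of PG(n-1, 2), consecutive ones sharing a point, that covers every point exactly once.

For n = 3 and n = 4, the vectors v_1, v_3, v_5, v_7 are forced to be linearly independent. This is
impossible for n = 3, and for n = 4 they may be taken to be the standard basis, which leaves a small
search.

For the step from n to n + 2, write Z_2^(n+2) = Z_2^n x F_4 and cut off the first two lines of a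
path for n. Multiplying the F_4-coordinate by suitable scalars along the path lifts the rest to four
disjoint paths, one for each element of F_4. The 19 points not covered by them can be used to link
the four lifts into one path, which reduces existence to n = 2, 5, 6.
*)

theory Submission
  imports Defs
begin

section \<open>Encoding vectors as natural numbers\<close>

lemma xor_nat_eq_0_iff: "xor x y = 0 \<longleftrightarrow> x = y" for x y :: nat
  by (metis xor.assoc xor.right_neutral xor_self_eq xor.left_neutral)

lemma xor_nat_less_power: "x < 2 ^ n \<Longrightarrow> y < 2 ^ n \<Longrightarrow> xor x y < 2 ^ n" for x y :: nat
  by (metis take_bit_nat_eq_self_iff take_bit_xor)

lemma xor_nat_left_cancel: "xor x (xor x y) = y" for x y :: nat
  by (simp flip: xor.assoc)

lemma xor_times_4_add:
  fixes u v x y :: nat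
  assumes "x < 4" "y < 4"
  shows "xor (4 * u + x) (4 * v + y) = 4 * xor u v + xor x y"
proof -
  let ?w = "xor (4 * u + x) (4 * v + y)"
  have "?w div 4 = xor u v"
    using drop_bit_xor[of 2 "4 * u + x" "4 * v + y"] assms by (simp add: drop_bit_eq_div)
  moreover have "?w mod 4 = xor x y"
    using take_bit_xor[of 2 "4 * u + x" "4 * v + y"] take_bit_xor[of 2 x y] assms
    by (simp add: take_bit_eq_mod)
  ultimately show ?thesis
    by (metis mult_div_mod_eq)
qed

section \<open>The isomorphism from numbers below \<open>2 ^ n\<close> under xor to
  \<open>Z_2^n\<close>\<close>

text \<open>The restriction is there because carrier elements of a product group are extensional
  functions.\<close>

definition bit_vector :: "nat \<Rightarrow> nat \<Rightarrow> nat \<Rightarrow> int" where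
  "bit_vector n m = (\<lambda>i\<in>{..<n}. of_bool (bit m i))"

lemma bit_vector_xor:
  "bit_vector n (xor x y) = bit_vector n x \<otimes>\<^bsub>Z2_power n\<^esub> bit_vector n y"
  by (auto simp: bit_vector_def Z2_power_def bit_xor_iff intro!: restrict_ext)

lemma bit_vector_0: "bit_vector n 0 = \<one>\<^bsub>Z2_power n\<^esub>"
  by (simp add: bit_vector_def Z2_power_def)

lemma inj_on_bit_vector: "inj_on (bit_vector n) {..<2 ^ n}"
proof (rule inj_onI)
  fix x y :: nat
  assume "x \<in> {..<2 ^ n}" "y \<in> {..<2 ^ n}" and eq: "bit_vector n x = bit_vector n y"
  then have xy: "take_bit n x = x" "take_bit n y = y"
    by (simp_all only: lessThan_iff take_bit_nat_eq_self_iff)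
  have "bit x i = bit y i" if "i < n" for i
  proof -
    have "(of_bool (bit x i) :: int) = of_bool (bit y i)"
      using fun_cong[OF eq, of i] that by (simp only: bit_vector_def restrict_apply' lessThan_iff)
    then show ?thesis
      by (simp only: of_bool_eq_iff)
  qed
  then have "take_bit n x = take_bit n y"
    by (intro bit_eqI) (auto simp: bit_take_bit_iff)
  with xy show "x = y" by metis
qed

lemma carrier_Z2_power: "carrier (Z2_power n) = PiE {..<n} (\<lambda>_. {0, 1})"
proof -
  have "{0..<2::int} = {0, 1}" by auto
  then show ?thesis by (simp add: Z2_power_def carrier_integer_mod_group)
qed

lemma bij_betw_bit_vector: "bij_betw (bit_vector n) {..<2 ^ n} (carrier (Z2_power n))"
  unfolding bij_betw_def
proof
  show "inj_on (bit_vector n) {..<2 ^ n}" by (rule inj_on_bit_vector)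
  have "card {0, 1::int} = 2"
    by simp
  then have "card (carrier (Z2_power n)) = 2 ^ n"
    unfolding carrier_Z2_power by (subst card_PiE) (simp_all del: card_insert_disjoint)
  then have "card (bit_vector n ` {..<2 ^ n}) = card (carrier (Z2_power n))"
    by (simp add: card_image[OF inj_on_bit_vector])
  moreover have "bit_vector n ` {..<2 ^ n} \<subseteq> carrier (Z2_power n)"
    unfolding carrier_Z2_power by (intro image_subsetI PiE_I) (simp_all add: bit_vector_def)
  moreover have "finite (carrier (Z2_power n))"
    by (simp add: carrier_Z2_power finite_PiE)
  ultimately show "bit_vector n ` {..<2 ^ n} = carrier (Z2_power n)"
    by (intro card_subset_eq)
qed

lemma bij_betw_bit_vector_nonzero:
  "bij_betw (bit_vector n) {1..2 ^ n - 1} (nonzero_vectors n)"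
proof -
  have "bit_vector n ` ({..<2 ^ n} - {0}) = carrier (Z2_power n) - {bit_vector n 0}"
    unfolding bij_betw_imp_surj_on[OF bij_betw_bit_vector, symmetric]
    by (subst inj_on_image_set_diff[OF inj_on_bit_vector]) auto
  then have "bij_betw (bit_vector n) ({..<2 ^ n} - {0}) (carrier (Z2_power n) - {bit_vector n 0})"
    by (intro bij_betw_subset[OF bij_betw_bit_vector]) auto
  moreover have "{..<2 ^ n} - {0::nat} = {1..2 ^ n - 1}"
    by (intro subset_antisym subsetI; simp; arith)
  ultimately show ?thesis
    by (simp add: nonzero_vectors_def bit_vector_0)
qed

text \<open>In characteristic 2, three elements sum to zero exactly when the third is the sum of the
  other two.\<close>

definition xor_ternary :: "nat \<Rightarrow> (nat \<Rightarrow> nat) \<Rightarrow> bool" where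
  "xor_ternary n f \<longleftrightarrow> bij_betw f {1..2 ^ n - 1} {1..2 ^ n - 1} \<and>
     (\<forall>i\<in>{2..2 ^ n - 2}. even i \<longrightarrow> xor (f (i - 1)) (f i) = f (i + 1))"

lemma xor_ternary_iff_ternary_permutation:
  assumes "bij_betw f {1..2 ^ n - 1} {1..2 ^ n - 1}"
  shows "xor_ternary n f \<longleftrightarrow> ternary_permutation n (bit_vector n \<circ> f)"
proof -
  have "xor (f (i - 1)) (f i) = f (i + 1) \<longleftrightarrow>
      bit_vector n (f (i - 1)) \<otimes>\<^bsub>Z2_power n\<^esub> bit_vector n (f i) \<otimes>\<^bsub>Z2_power n\<^esub>
        bit_vector n (f (i + 1)) = \<one>\<^bsub>Z2_power n\<^esub>"
    if "i \<in> {2..2 ^ n - 2}" for i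
  proof -
    have *: "f j < 2 ^ n" if "j \<in> {1..2 ^ n - 1}" for j
      using bij_betw_apply[OF assms that] by auto
    have "f (i - 1) < 2 ^ n" "f i < 2 ^ n" "f (i + 1) < 2 ^ n"
      using that by (auto intro!: *)
    then have "xor (xor (f (i - 1)) (f i)) (f (i + 1)) \<in> {..<2 ^ n}"
      by (simp add: xor_nat_less_power)
    then show ?thesis
      using inj_on_eq_iff[OF inj_on_bit_vector, of _ n 0]
      by (simp add: xor_nat_eq_0_iff flip: bit_vector_xor bit_vector_0)
  qed
  then show ?thesis
    using assms bij_betw_trans[OF assms bij_betw_bit_vector_nonzero]
    by (simp add: xor_ternary_def ternary_permutation_def)
qed

lemma sequentially_ternary_iff_xor_ternary:
  "sequentially_ternary n \<longleftrightarrow> (\<exists>f. xor_ternary n f)"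
proof
  assume "sequentially_ternary n"
  then obtain v where v: "ternary_permutation n v"
    by (auto simp: sequentially_ternary_def)
  define f where "f = inv_into {1..2 ^ n - 1} (bit_vector n) \<circ> v"
  have bij: "bij_betw v {1..2 ^ n - 1} (nonzero_vectors n)"
    using v by (simp add: ternary_permutation_def)
  then have f: "bij_betw f {1..2 ^ n - 1} {1..2 ^ n - 1}"
    unfolding f_def by (rule bij_betw_trans[OF _ bij_betw_inv_into[OF bij_betw_bit_vector_nonzero]])
  have eq: "(bit_vector n \<circ> f) i = v i" if "i \<in> {1..2 ^ n - 1}" for i
    using bij_betw_inv_into_right[OF bij_betw_bit_vector_nonzero bij_betw_apply[OF bij that]]
    by (simp add: f_def)
  have "ternary_permutation n (bit_vector n \<circ> f)"
    unfolding ternary_permutation_def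
  proof (intro conjI ballI impI)
    show "bij_betw (bit_vector n \<circ> f) {1..2 ^ n - 1} (nonzero_vectors n)"
      by (rule bij_betw_trans[OF f bij_betw_bit_vector_nonzero])
    fix i :: nat assume i: "i \<in> {2..2 ^ n - 2}" "even i"
    then have mem: "i - 1 \<in> {1..2 ^ n - 1}" "i \<in> {1..2 ^ n - 1}" "i + 1 \<in> {1..2 ^ n - 1}"
      by auto
    have "v (i - 1) \<otimes>\<^bsub>Z2_power n\<^esub> v i \<otimes>\<^bsub>Z2_power n\<^esub> v (i + 1) = \<one>\<^bsub>Z2_power n\<^esub>"
      using v i unfolding ternary_permutation_def by blast
    then show "(bit_vector n \<circ> f) (i - 1) \<otimes>\<^bsub>Z2_power n\<^esub> (bit_vector n \<circ> f) i
        \<otimes>\<^bsub>Z2_power n\<^esub> (bit_vector n \<circ> f) (i + 1) = \<one>\<^bsub>Z2_power n\<^esub>"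
      unfolding mem[THEN eq] .
  qed
  then show "\<exists>f. xor_ternary n f"
    using xor_ternary_iff_ternary_permutation[OF f] by blast
next
  assume "\<exists>f. xor_ternary n f"
  then obtain f where f: "xor_ternary n f" ..
  then have "bij_betw f {1..2 ^ n - 1} {1..2 ^ n - 1}"
    by (simp add: xor_ternary_def)
  from xor_ternary_iff_ternary_permutation[OF this] f show "sequentially_ternary n"
    unfolding sequentially_ternary_def by blast
qed

section \<open>Nonexistence in dimensions 3 and 4\<close>

lemma less_16_cases:
  "m < 16 \<longleftrightarrow> m \<in> {0, 1, 2, 3, 4, 5, 6, 7, 8, 9, 10, 11, 12, 13, 14, 15}" for m :: nat
  by (auto simp: eval_nat_numeral less_Suc_eq)

text \<open>The linear map on \<open>Z_2^4\<close> sending the basis 1, 2, 4, 8 to \<open>a\<close>,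
  \<open>b\<close>, \<open>c\<close>, \<open>d\<close>.\<close>

definition xor_combination :: "nat \<Rightarrow> nat \<Rightarrow> nat \<Rightarrow> nat \<Rightarrow> nat \<Rightarrow> nat" where
  "xor_combination a b c d m =
     xor (xor (of_bool (bit m 0) * a) (of_bool (bit m 1) * b))
       (xor (of_bool (bit m 2) * c) (of_bool (bit m 3) * d))"

text \<open>Since \<open>f 2\<close>, \<open>f 4\<close>, \<open>f 6\<close> are the sums of their
  neighbours, a linear dependence would make one of \<open>f 1\<close>, ..., \<open>f 7\<close> zero
  or two of them equal. For \<open>n = 3\<close> the injection puts 16 elements into 8; for
  \<open>n = 4\<close> it is an automorphism.\<close>

lemma xor_ternary_first_four_independent:
  assumes f: "xor_ternary n f" and "n \<ge> 3"
  defines "\<phi> \<equiv> xor_combination (f 1) (f 3) (f 5) (f 7)"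
  shows "inj_on \<phi> {..<16}"
    and "\<phi> ` {..<16} \<subseteq> {..<2 ^ n}"
    and "\<phi> (xor x y) = xor (\<phi> x) (\<phi> y)"
proof -
  have hom: "\<phi> (xor x y) = xor (\<phi> x) (\<phi> y)" for x y
    by (auto simp: \<phi>_def xor_combination_def bit_xor_iff xor.assoc xor.commute xor.left_commute
        xor_nat_left_cancel)
  then show "\<phi> (xor x y) = xor (\<phi> x) (\<phi> y)" .
  have "(2::nat) ^ 3 \<le> 2 ^ n" using \<open>n \<ge> 3\<close> by (intro power_increasing) auto
  then have n: "8 \<le> (2::nat) ^ n" by simp
  have bij: "bij_betw f {1..2 ^ n - 1} {1..2 ^ n - 1}"
    and step: "\<And>i. i \<in> {2..2 ^ n - 2} \<Longrightarrow> even i \<Longrightarrow> xor (f (i - 1)) (f i) = f (i + 1)"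
    using f by (auto simp: xor_ternary_def)
  have range: "f i \<in> {1..2 ^ n - 1}" if "i \<in> {1..7}" for i
    using that n by (intro bij_betw_apply[OF bij]) auto
  then have "f i < 2 ^ n" if "i \<in> {1..7}" for i
    using that by fastforce
  then have "f 1 < 2 ^ n" "f 3 < 2 ^ n" "f 5 < 2 ^ n" "f 7 < 2 ^ n"
    by auto
  then show "\<phi> ` {..<16} \<subseteq> {..<2 ^ n}"
    by (auto simp: \<phi>_def xor_combination_def intro!: xor_nat_less_power)
  have "inj_on f {1..7}"
    by (rule inj_on_subset[OF bij_betw_imp_inj_on[OF bij]]) (use n in auto)
  then have "distinct [f 1, f 2, f 3, f 4, f 5, f 6, f 7]"
    by (simp add: inj_on_eq_iff)
  moreover have "f 2 = xor (f 1) (f 3)" "f 4 = xor (f 3) (f 5)" "f 6 = xor (f 5) (f 7)"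
    using step[of 2] step[of 4] step[of 6] n
      xor_nat_left_cancel[of "f 1" "f 2"] xor_nat_left_cancel[of "f 3" "f 4"]
      xor_nat_left_cancel[of "f 5" "f 6"] by simp_all
  moreover have "f 1 \<noteq> 0" "f 3 \<noteq> 0" "f 5 \<noteq> 0" "f 7 \<noteq> 0"
    using range[of 1] range[of 3] range[of 5] range[of 7] by auto
  ultimately have ne: "f 1 \<noteq> 0" "f 3 \<noteq> 0" "f 5 \<noteq> 0" "f 7 \<noteq> 0"
    "xor (f 1) (f 3) \<noteq> 0" "xor (f 1) (f 5) \<noteq> 0" "xor (f 1) (f 7) \<noteq> 0"
    "xor (f 3) (f 5) \<noteq> 0" "xor (f 3) (f 7) \<noteq> 0" "xor (f 5) (f 7) \<noteq> 0"
    "xor (f 5) (xor (f 1) (f 3)) \<noteq> 0" "xor (f 7) (xor (f 1) (f 3)) \<noteq> 0"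
    "xor (f 1) (xor (f 5) (f 7)) \<noteq> 0" "xor (f 7) (xor (f 3) (f 5)) \<noteq> 0"
    "xor (xor (f 1) (f 3)) (xor (f 5) (f 7)) \<noteq> 0"
    unfolding xor_nat_eq_0_iff by auto
  \<comment> \<open>Each of the 15 nonempty sums of \<open>f 1, f 3, f 5, f 7\<close> is one of the seven values \<open>f 1, \<dots>, f 7\<close> or a sum
    of two different ones.\<close>
  have nz: "\<phi> z \<noteq> 0" if "z \<noteq> 0" "z < 16" for z
    using ne that unfolding less_16_cases
    by (elim insertE emptyE; hypsubst; simp add: \<phi>_def xor_combination_def bit_iff_odd
        xor.assoc xor.commute xor.left_commute)
  show "inj_on \<phi> {..<16}"
  proof (rule inj_onI)
    fix x y assume "x \<in> {..<16::nat}" "y \<in> {..<16}" "\<phi> x = \<phi> y"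
    then have "\<phi> (xor x y) = 0" "xor x y < 16"
      using xor_nat_less_power[of x 4 y] by (simp_all add: hom)
    then show "x = y"
      using nz[of "xor x y"] by (auto simp: xor_nat_eq_0_iff)
  qed
qed

lemma not_xor_ternary_3: "\<not> xor_ternary 3 f"
proof
  assume f: "xor_ternary 3 f"
  show False
    using card_inj_on_le[OF xor_ternary_first_four_independent(1,2)[OF f]] by simp
qed

text \<open>The list is zero followed by a path with line ends 1, 2, 4, 8, \<open>p\<close>,
  \<open>q\<close>, \<open>r\<close>, \<open>s\<close>. Distinctness of longer and longer prefixes
  leaves at most 4 choices of \<open>p\<close>, 12 of \<open>p\<close>, \<open>q\<close>, 8 of
  \<open>p\<close>, \<open>q\<close>, \<open>r\<close>, and finally none.\<close>

lemma no_ternary_extension_of_standard_basis: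
  fixes p q r s :: nat
  assumes "p < 16" "q < 16" "r < 16" "s < 16"
    and dist: "distinct [0, 1, 3, 2, 6, 4, 12, 8, xor 8 p, p, xor p q, q, xor q r, r, xor r s, s]"
  shows False
proof -
  have "distinct [0, 1, 3, 2, 6, 4, 12, 8, xor 8 p, p]"
    using dist by simp
  then have p: "p = 5 \<or> p = 7 \<or> p = 13 \<or> p = 15"
    using \<open>p < 16\<close> unfolding less_16_cases by (elim insertE emptyE; hypsubst; simp)
  have "distinct [0, 1, 3, 2, 6, 4, 12, 8, xor 8 p, p, xor p q, q]"
    using dist by simp
  then have pq: "p = 5 \<and> (q = 14 \<or> q = 10 \<or> q = 11 \<or> q = 15) \<or>
      p = 7 \<and> (q = 14 \<or> q = 9 \<or> q = 10 \<or> q = 13) \<or>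
      p = 13 \<and> (q = 7 \<or> q = 10) \<or> p = 15 \<and> (q = 5 \<or> q = 10)"
    using p \<open>q < 16\<close> unfolding less_16_cases by (elim insertE emptyE disjE; hypsubst; simp)
  have "distinct [0, 1, 3, 2, 6, 4, 12, 8, xor 8 p, p, xor p q, q, xor q r, r]"
    using dist by simp
  then have pqr: "p = 5 \<and> q = 14 \<and> (r = 7 \<or> r = 9) \<or> p = 7 \<and> q = 14 \<and> (r = 5 \<or> r = 11) \<or>
      p = 13 \<and> q = 7 \<and> (r = 9 \<or> r = 14) \<or> p = 15 \<and> q = 5 \<and> (r = 11 \<or> r = 14)"
    using pq \<open>r < 16\<close> unfolding less_16_cases
    by (elim insertE emptyE disjE conjE; hypsubst; simp)
  show False
    using dist pqr \<open>s < 16\<close> unfolding less_16_cases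
    by (elim insertE emptyE disjE conjE; hypsubst; simp)
qed

lemma not_xor_ternary_4: "\<not> xor_ternary 4 f"
proof
  assume f: "xor_ternary 4 f"
  define \<phi> where "\<phi> = xor_combination (f 1) (f 3) (f 5) (f 7)"
  have \<phi>: "inj_on \<phi> {..<16}" "\<phi> ` {..<16} \<subseteq> {..<16}" "\<And>x y. \<phi> (xor x y) = xor (\<phi> x) (\<phi> y)"
    using xor_ternary_first_four_independent[OF f] by (simp_all add: \<phi>_def)
  \<comment> \<open>An injective self-map of a finite set is onto, so every \<open>f i\<close> can
    be pulled back along \<open>\<phi>\<close>; \<open>f 1\<close>, \<open>f 3\<close>,
    \<open>f 5\<close>, \<open>f 7\<close> become 1, 2, 4, 8.\<close>
  have \<phi>_surj: "\<phi> ` {..<16} = {..<16}"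
    using \<phi>(1,2) by (simp add: endo_inj_surj)
  have bij: "bij_betw f {1..15} {1..15}"
    and step: "\<And>i. i \<in> {2..14} \<Longrightarrow> even i \<Longrightarrow> xor (f (i - 1)) (f i) = f (i + 1)"
    using f by (auto simp: xor_ternary_def)
  have ex: "\<exists>m<16. f i = \<phi> m" if "i \<in> {1..15}" for i
  proof -
    have "f i \<in> \<phi> ` {..<16}"
      using bij_betw_apply[OF bij that] by (simp add: \<phi>_surj)
    then show ?thesis
      by auto
  qed
  obtain p where p: "p < 16" "f 9 = \<phi> p" using ex[of 9] by auto
  obtain q where q: "q < 16" "f 11 = \<phi> q" using ex[of 11] by auto
  obtain r where r: "r < 16" "f 13 = \<phi> r" using ex[of 13] by auto
  obtain s where s: "s < 16" "f 15 = \<phi> s" using ex[of 15] by auto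
  note pqrs = p(2) q(2) r(2) s(2)
  let ?is = "[1, 3, 2, 6, 4, 12, 8, xor 8 p, p, xor p q, q, xor q r, r, xor r s, s]"
  have \<phi>_basis: "\<phi> 0 = 0" "\<phi> 1 = f 1" "\<phi> (Suc 0) = f 1" "\<phi> 2 = f 3" "\<phi> 4 = f 5" "\<phi> 8 = f 7"
    by (simp_all add: \<phi>_def xor_combination_def bit_iff_odd)
  have mid: "f i = xor (f (i - 1)) (f (i + 1))" if "i \<in> {2..14}" "even i" for i
    using step[OF that] by (metis xor_nat_left_cancel)
  have \<phi>_even: "\<phi> 3 = f 2" "\<phi> 6 = f 4" "\<phi> 12 = f 6"
    "\<phi> (xor 8 p) = f 8" "\<phi> (xor p q) = f 10" "\<phi> (xor q r) = f 12" "\<phi> (xor r s) = f 14"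
    using \<phi>(3)[of 1 2] \<phi>(3)[of 2 4] \<phi>(3)[of 4 8] \<phi>(3)[of 8 p] \<phi>(3)[of p q] \<phi>(3)[of q r]
      \<phi>(3)[of r s] mid[of 2] mid[of 4] mid[of 6] mid[of 8] mid[of 10] mid[of 12] mid[of 14]
    by (simp_all add: \<phi>_basis pqrs)
  have "distinct (0 # map f [1..<16])"
    using bij by (auto simp: distinct_map bij_betw_def
        atLeastLessThanSuc_atLeastAtMost[of 1 15, simplified] simp del: upt_rec_numeral)
  moreover have "[1..<16] = [1, 2, 3, 4, 5, 6, 7, 8, 9, 10, 11, 12, 13, 14, 15]"
    by (simp add: upt_conv_Cons)
  \<comment> \<open>\<open>\<phi>\<close> maps the list of the finite search entrywise to 0,
    \<open>f 1\<close>, ..., \<open>f 15\<close>, so distinctness pulls back.\<close>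
  then have "map \<phi> (0 # ?is) = 0 # map f [1..<16]"
    by (simp only: list.map \<phi>_basis \<phi>_even pqrs)
  ultimately have "distinct (map \<phi> (0 # ?is))"
    by (simp only:)
  then have "distinct (0 # ?is)"
    by (simp only: distinct_map)
  then show False
    using no_ternary_extension_of_standard_basis p(1) q(1) r(1) s(1) by blast
qed

section \<open>Existence\<close>

text \<open>Counting from 0, odd positions are the middles of lines and inner even positions the
  points shared by consecutive lines. The last clause accepts a single point and rejects lengths 0
  and 2, so every path has odd length.\<close>

fun loose_path :: "nat list \<Rightarrow> bool" where
  "loose_path (a # b # c # xs) \<longleftrightarrow> xor a b = c \<and> loose_path (c # xs)"
| "loose_path xs \<longleftrightarrow> length xs = 1"

text \<open>Paths glue at a common end: \<open>last xs\<close> belongs to both halves but is listed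
  once.\<close>

lemma loose_path_append:
  "loose_path xs \<Longrightarrow> loose_path (xs @ ys) \<longleftrightarrow> loose_path (last xs # ys)"
  by (induction xs rule: loose_path.induct) (auto simp: length_Suc_conv)

lemma loose_path_rev: "loose_path xs \<Longrightarrow> loose_path (rev xs)"
proof (induction xs rule: loose_path.induct)
  case (1 a b c xs)
  then show ?case
    using loose_path_append[of "rev (c # xs)" "[b, a]"] by (auto simp: xor.assoc)
qed auto

text \<open>List positions start at 0, so the odd \<open>i\<close> here are the even indices of
  \<open>xor_ternary\<close>, less one.\<close>

lemma loose_path_nth:
  "loose_path xs \<Longrightarrow> odd i \<Longrightarrow> Suc i < length xs \<Longrightarrow> xor (xs ! (i - 1)) (xs ! i) = xs ! Suc i"
proof (induction xs arbitrary: i rule: loose_path.induct)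
  case (1 a b c xs)
  show ?case
  proof (cases "i = 1")
    case True
    with 1 show ?thesis by simp
  next
    case False
    with 1(3) obtain k where "i = Suc (Suc k)" "odd k"
      by (metis One_nat_def even_Suc not0_implies_Suc odd_pos gr_implies_not0)
    with 1 show ?thesis
      using "1.IH"[of k] by (cases k) auto
  qed
qed auto

lemma xor_ternary_loose_path:
  assumes "loose_path xs" "distinct xs" "set xs = {1..<2 ^ n}"
  shows "xor_ternary n (\<lambda>i. xs ! (i - 1))"
  unfolding xor_ternary_def
proof (intro conjI ballI impI)
  have len: "length xs = 2 ^ n - 1"
    using distinct_card[OF assms(2)] assms(3) by simp
  have "{1..<2 ^ n} = {1..2 ^ n - (1 :: nat)}"
    by (intro subset_antisym subsetI; simp; arith)
  then have "bij_betw ((!) xs) {..<2 ^ n - 1} {1..2 ^ n - 1}"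
    using bij_betw_nth[OF assms(2), of "{..<2 ^ n - 1}" "{1..<2 ^ n}"] assms(3) len by simp
  moreover have "bij_betw (\<lambda>i. i - 1) {1..2 ^ n - 1} {..<2 ^ n - (1 :: nat)}"
    by (rule bij_betw_byWitness[where f' = Suc]) auto
  ultimately show "bij_betw (\<lambda>i. xs ! (i - 1)) {1..2 ^ n - 1} {1..2 ^ n - 1}"
    using bij_betw_trans[of "\<lambda>i. i - 1" _ _ "(!) xs"] by (simp add: comp_def)
  fix i :: nat
  assume i: "i \<in> {2..2 ^ n - 2}" "even i"
  then have "odd (i - 1)" "Suc (i - 1) < length xs"
    unfolding len by auto
  from loose_path_nth[OF assms(1) this] i
  show "xor (xs ! (i - 1 - 1)) (xs ! (i - 1)) = xs ! (i + 1 - 1)"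
    by simp
qed

section \<open>Lifts of a path to \<open>Z_2^n x F_4\<close>\<close>

text \<open>\<open>point u x\<close> stands for \<open>(u, x)\<close> in \<open>Z_2^n \<times> F_4\<close>; the values \<open>0, 1, 2, 3\<close> of \<open>x\<close> with
  \<open>xor\<close> are the additive group of \<open>F_4\<close>, and \<open>0 \<mapsto> 0\<close>, \<open>1 \<mapsto> 2 \<mapsto> 3 \<mapsto> 1\<close> is multiplication by a
  generator.\<close>

definition point :: "nat \<Rightarrow> nat \<Rightarrow> nat" where
  "point u x = 4 * u + x"

lemma xor_point:
  "x < 4 \<Longrightarrow> y < 4 \<Longrightarrow> xor (point u x) (point v y) = point (xor u v) (xor x y)"
  by (simp add: point_def xor_times_4_add)

lemma point_eq_iff: "x < 4 \<Longrightarrow> y < 4 \<Longrightarrow> point u x = point v y \<longleftrightarrow> u = v \<and> x = y"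
  unfolding point_def by arith

lemma point_div_4: "x < 4 \<Longrightarrow> point u x div 4 = u"
  by (simp add: point_def)

lemma xor_less_4: "x < 4 \<Longrightarrow> y < 4 \<Longrightarrow> xor x y < 4" for x y :: nat
  using xor_nat_less_power[of x 2 y] by simp

text \<open>In the lifts used below \<open>y = \<alpha>x\<close> for the generator \<open>\<alpha>\<close>: the scalars along the path are
  \<open>1, 1 + \<alpha>, \<alpha>, 1 + \<alpha>, 1, \<dots>\<close>. They are nonzero, so different \<open>x\<close> give disjoint lifts.\<close>

fun strand :: "nat \<Rightarrow> nat \<Rightarrow> nat list \<Rightarrow> nat list" where
  "strand x y (a # b # zs) = point a x # point b (xor x y) # strand y x zs"
| "strand x y [a] = [point a x]"
| "strand x y [] = []"

lemma strand_Cons: "strand x y (a # zs) = point a x # tl (strand x y (a # zs))"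
  by (cases zs) auto

lemma map_div_4_strand: "x < 4 \<Longrightarrow> y < 4 \<Longrightarrow> map (\<lambda>v. v div 4) (strand x y zs) = zs"
  by (induction x y zs rule: strand.induct) (auto simp: point_div_4 xor_less_4)

lemma div_4_strand:
  "x < 4 \<Longrightarrow> y < 4 \<Longrightarrow> v \<in> set (strand x y zs) \<Longrightarrow> v div 4 \<in> set zs"
  by (metis (mono_tags, lifting) map_div_4_strand image_eqI set_map)

lemma length_strand: "length (strand x y zs) = length zs"
  by (induction x y zs rule: strand.induct) auto

lemma distinct_strand: "distinct zs \<Longrightarrow> x < 4 \<Longrightarrow> y < 4 \<Longrightarrow> distinct (strand x y zs)"
  by (metis map_div_4_strand distinct_map)

text \<open>Over a line the coordinates are \<open>x\<close>, \<open>xor x y\<close>,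
  \<open>y\<close>, with sum zero. The next line starts at \<open>y\<close>, which is why
  \<open>strand\<close> swaps its arguments.\<close>

lemma loose_path_strand:
  "loose_path zs \<Longrightarrow> x < 4 \<Longrightarrow> y < 4 \<Longrightarrow> loose_path (strand x y zs)"
proof (induction zs arbitrary: x y rule: loose_path.induct)
  case (1 a b c xs)
  then have "loose_path (point c y # tl (strand y x (c # xs)))"
    by (metis strand_Cons loose_path.simps(1))
  then have "loose_path (point a x # point b (xor x y) # point c y # tl (strand y x (c # xs)))"
    using 1 by (simp add: xor_point xor_less_4 xor_nat_left_cancel)
  then show ?case
    by (metis strand_Cons strand.simps(1))
qed auto

text \<open>At the ends of lines the coordinate alternates between \<open>x\<close> and
  \<open>y\<close>, hence has period 4 in list positions.\<close>

lemma last_strand: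
  "odd (length zs) \<Longrightarrow>
    last (strand x y zs) = point (last zs) (if length zs mod 4 = 1 then x else y)"
proof (induction x y zs rule: strand.induct)
  case (1 x y a b zs)
  then have "zs \<noteq> []" "odd (length zs)" by auto
  moreover from this have "strand y x zs \<noteq> []"
    by (metis length_0_conv length_strand)
  moreover have "length (a # b # zs) mod 4 = 1 \<longleftrightarrow> length zs mod 4 \<noteq> 1"
    using \<open>odd (length zs)\<close> unfolding list.size by presburger
  ultimately show ?case
    using 1 by simp
qed auto

text \<open>Over each point the two lifts carry \<open>x\<close> and \<open>x'\<close>,
  \<open>y\<close> and \<open>y'\<close>, or the two sums. The hypotheses are symmetric under the
  swap made by \<open>strand\<close>, so they survive the induction.\<close>

lemma disjoint_strands:
  assumes "distinct zs" "x < 4" "y < 4" "x' < 4" "y' < 4"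
    and "x \<noteq> x'" "y \<noteq> y'" "xor x y \<noteq> xor x' y'"
  shows "set (strand x y zs) \<inter> set (strand x' y' zs) = {}"
  using assms
proof (induction zs arbitrary: x y x' y' rule: induct_list012)
  case (3 a b zs)
  have "set (strand y x zs) \<inter> set (strand y' x' zs) = {}"
    using 3 by (intro "3.IH") (simp_all add: xor.commute)
  moreover have "point u k \<notin> set (strand y x zs)" "point u k \<notin> set (strand y' x' zs)"
    if "u \<in> {a, b}" "k < 4" for u k
    using that "3.prems" div_4_strand[of y x "point u k" zs] div_4_strand[of y' x' "point u k" zs]
    by (auto simp: point_div_4)
  moreover have "a \<noteq> b" using "3.prems" by simp
  ultimately show ?case
    using "3.prems" by (simp add: point_eq_iff xor_less_4)
qed (auto simp: point_eq_iff)

section \<open>Extension by two dimensions\<close>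

lemma loose_path_extend:
  assumes lp: "loose_path (p1 # p2 # p3 # p4 # a # zs)"
    and dist: "distinct (p1 # p2 # p3 # p4 # a # zs)"
    and set: "set (p1 # p2 # p3 # p4 # a # zs) = {1..<2 ^ n}" and "n \<ge> 3"
  shows "\<exists>ys. loose_path ys \<and> distinct ys \<and> set ys = {1..<2 ^ (n + 2)}"
proof -
  define z where "z = a # zs"
  define S where "S x y = strand x y z" for x y
  \<comment> \<open>\<open>F1\<close> and \<open>F2\<close> were found by computer search: they partition the points over \<open>p1, \<dots>, p4\<close> and
    two of the points over \<open>0\<close>. The third point over \<open>0\<close> joins two lifts at their far ends.\<close>
  define F1 where "F1 = [point p4 0, point p3 1, point p1 0, point p2 1, point 0 1, point p2 0,
    point p1 2, point p3 2, point p4 2]"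
  define F2 where "F2 = [point p4 1, point p3 3, point p2 2, point p1 1, point 0 2, point p1 3,
    point p2 3, point p3 0, point p4 3]"
  \<comment> \<open>With \<open>e\<close> the last point of \<open>z\<close>: backwards along a lift
    to \<open>(a, 1)\<close>, through \<open>F1\<close> to \<open>(a, 0)\<close>, along a lift to
    \<open>(e, 0)\<close>, over \<open>(0, 3)\<close> to \<open>(e, 3)\<close>, backwards along a
    lift to \<open>(a, 2)\<close>, through \<open>F2\<close> to \<open>(a, 3)\<close>, and out along
    the last lift.\<close>
  define F where "F = rev (S 1 2) @ F1 @ S 0 0 @ [point 0 3] @ rev (S 2 3) @ F2 @ S 3 1"
  have len: "length (p1 # p2 # p3 # p4 # a # zs) = 2 ^ n - 1"
    using distinct_card[OF dist] set by simp
  \<comment> \<open>As 8 divides \<open>2 ^ n\<close>, the length of \<open>z\<close> is 3 modulo 8,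
    so \<open>S x y\<close> ends with coordinate \<open>y\<close>.\<close>
  have "(2::nat) ^ n = 2 ^ (n - 3) * 2 ^ 3"
    using \<open>n \<ge> 3\<close> by (simp only: power_add[symmetric] le_add_diff_inverse2)
  then obtain k where pow_n: "(2::nat) ^ n = 8 * k"
    by simp
  have len_z: "length z = 2 ^ n - 5" and "length z > 0"
    using len by (simp_all add: z_def)
  moreover from this obtain j where "k = Suc j"
    by (cases k) (auto simp: pow_n)
  ultimately have "length z = 8 * j + 3"
    by (simp add: pow_n)
  then have len_z_mod: "length z mod 4 \<noteq> 1" "odd (length z)"
    by presburger+
  have last: "last (S x y) = point (last z) y" for x y
    unfolding S_def last_strand[OF len_z_mod(2)] using len_z_mod(1) by (simp only: if_False)
  have z: "loose_path z" and p3: "xor p1 p2 = p3" and a: "xor p3 p4 = a"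
    using lp by (auto simp: z_def)
  have S: "loose_path (S x y)" if "x < 4" "y < 4" for x y
    using loose_path_strand[OF z that] by (simp add: S_def)
  have hd: "\<exists>w. S x y = point a x # w" for x y
    unfolding S_def z_def by (metis strand_Cons)
  obtain w0 where w0: "S 0 0 = point a 0 # w0" using hd by blast
  obtain w3 where w3: "S 3 1 = point a 3 # w3" using hd by blast
  have "S 2 3 = butlast (S 2 3) @ [point (last z) 3]"
    by (metis append_butlast_last_id hd last list.discI)
  then have r: "rev (S 2 3) = point (last z) 3 # rev (butlast (S 2 3))"
    by (simp only: rev_eq_Cons_iff rev_rev_ident)
  have last_rev: "last (rev (S x y)) = point a x" for x y
    using hd[of x y] by auto
  have xors: "xor p2 p1 = p3" "xor p3 p1 = p2" "xor p3 p2 = p1" "xor a p4 = p3"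
    using p3 a by (metis xor.commute xor_nat_left_cancel)+
  \<comment> \<open>The path is assembled from its right end: connecting pieces are checked line by
    line, lifts are glued on by \<open>loose_path_append\<close>.\<close>
  have "loose_path (point a 2 # F2 @ point a 3 # w3)"
    using S[of 3 1, unfolded w3] by (simp add: F2_def xor_point xors p3 a)
  then have "loose_path (rev (S 2 3) @ F2 @ S 3 1)"
    unfolding w3 by (simp add: loose_path_append loose_path_rev S last_rev)
  then have "loose_path (point (last z) 0 # point 0 3 # rev (S 2 3) @ F2 @ S 3 1)"
    by (simp add: r xor_point)
  then have "loose_path (S 0 0 @ point 0 3 # rev (S 2 3) @ F2 @ S 3 1)"
    by (simp add: loose_path_append S last)
  then have "loose_path (point a 1 # F1 @ S 0 0 @ point 0 3 # rev (S 2 3) @ F2 @ S 3 1)"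
    by (simp add: w0 F1_def xor_point xors p3 a)
  then have "loose_path F"
    unfolding F_def by (simp add: loose_path_append loose_path_rev S last_rev)
  have dist_z: "distinct z" and p_z: "p1 \<notin> set z" "p2 \<notin> set z" "p3 \<notin> set z" "p4 \<notin> set z"
    and p: "distinct [p1, p2, p3, p4]"
    using dist by (auto simp: z_def)
  have z_range: "set z \<subseteq> {1..<2 ^ n}" and p_range: "{p1, p2, p3, p4} \<subseteq> {1..<2 ^ n}"
    unfolding set[symmetric] by (auto simp: z_def)
  have in_S: "v div 4 \<in> set z" if "v \<in> set (S x y)" "x < 4" "y < 4" for v x y
    using div_4_strand that by (simp add: S_def)
  have "0 \<notin> set z" using z_range by auto
  have notin_S: "point u k \<notin> set (S x y)" if "u \<in> {0, p1, p2, p3, p4}" "k < 4" "x < 4" "y < 4" for u k x y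
    using that in_S[of "point u k" x y] p_z \<open>0 \<notin> set z\<close> by (auto simp: point_div_4)
  have notin_F: "v \<notin> set (F1 @ F2 @ [point 0 3])" if "v \<in> set (S x y)" "x < 4" "y < 4" for v x y
    using notin_S[of _ _ x y] that by (auto simp: F1_def F2_def)
  have "distinct (F1 @ F2 @ [point 0 3])"
    using p p_range by (simp add: F1_def F2_def point_eq_iff)
  moreover have "distinct (S x y)" if "x < 4" "y < 4" for x y
    using distinct_strand[OF dist_z that] by (simp add: S_def)
  moreover have "set (S 1 2) \<inter> set (S 0 0) = {}" "set (S 1 2) \<inter> set (S 2 3) = {}"
    "set (S 1 2) \<inter> set (S 3 1) = {}" "set (S 0 0) \<inter> set (S 2 3) = {}"
    "set (S 0 0) \<inter> set (S 3 1) = {}" "set (S 2 3) \<inter> set (S 3 1) = {}"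
    unfolding S_def by (rule disjoint_strands[OF dist_z]; simp)+
  ultimately have "distinct F"
    using notin_F[of _ 1 2] notin_F[of _ 0 0] notin_F[of _ 2 3] notin_F[of _ 3 1]
    unfolding F_def by (simp add: disjoint_iff) blast
  moreover have "set F = {1..<2 ^ (n + 2)}"
  \<comment> \<open>Counting gives surjectivity: four lifts of \<open>2 ^ n - 5\<close> points and
    19 connecting points make \<open>2 ^ (n + 2) - 1\<close>.\<close>
  proof (rule card_subset_eq)
    have "length F = 4 * length z + 19"
      by (simp add: F_def F1_def F2_def S_def length_strand)
    also have "\<dots> = 2 ^ (n + 2) - 1"
      using len_z \<open>length z > 0\<close> by simp
    finally show "card (set F) = card {1..<2 ^ (n + 2)::nat}"
      using distinct_card[OF \<open>distinct F\<close>] by simp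
    have "v \<in> {1..<2 ^ (n + 2)}" if "v \<in> set (S x y)" "x < 4" "y < 4" for v x y
    proof -
      have "v div 4 \<in> {1..<2 ^ n}" using in_S[OF that] z_range by auto
      then show ?thesis by (auto simp: div_less_iff_less_mult)
    qed
    moreover have "set (F1 @ F2 @ [point 0 3]) \<subseteq> {1..<2 ^ (n + 2)}"
      using p_range pow_n by (auto simp: F1_def F2_def point_def)
    ultimately show "set F \<subseteq> {1..<2 ^ (n + 2)}"
      unfolding F_def by auto
  qed simp
  ultimately show ?thesis
    using \<open>loose_path F\<close> by blast
qed

text \<open>The step by 2 cannot start at 2, as it would reach 4; odd and even dimensions therefore
  start at 5 and 6.\<close>

lemma ex_loose_path:
  assumes "n = 2 \<or> n \<ge> 5"
  shows "\<exists>xs. loose_path xs \<and> distinct xs \<and> set xs = {1..<2 ^ n}"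
  using assms
proof (induction n rule: less_induct)
  case (less n)
  consider "n = 2" | "n = 5" | "n = 6" | "n \<ge> 7"
    using less.prems by linarith
  then show ?case
  proof cases
    case 1
    show ?thesis
      unfolding 1 by (intro exI[of _ "[1, 3, 2]"] conjI) code_simp+
  next
    case 2
    show ?thesis
      \<comment> \<open>An explicit path through all 31 points, checked by evaluation.\<close>
      unfolding 2
      by (intro exI[of _ "[1, 25, 24, 5, 29, 13, 16, 14, 30, 4, 26, 8, 18, 21, 7, 28,
        27, 20, 15, 3, 12, 10, 6, 23, 17, 19, 2, 11, 9, 31, 22]"] conjI) code_simp+
  next
    case 3
    show ?thesis
      unfolding 3
      by (intro exI[of _ "[1, 53, 52, 3, 55, 19, 36, 14, 42, 54, 28, 49, 45, 37, 8, 30,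
        22, 26, 12, 27, 23, 29, 10, 18, 24, 43, 51, 38, 21, 47, 58, 61, 7, 2, 5, 39, 34, 25,
        59, 9, 50, 63, 13, 46, 35, 15, 44, 4, 40, 60, 20, 11, 31, 33, 62, 6, 56, 17, 41, 57,
        16, 32, 48]"] conjI) code_simp+
  next
    case 4
    then obtain xs where xs: "loose_path xs" "distinct xs" "set xs = {1..<2 ^ (n - 2)}"
    proof -
      have "n - 2 < n" "n - 2 = 2 \<or> n - 2 \<ge> 5"
        using 4 by linarith+
      then show ?thesis
        using less.IH that by blast
    qed
    \<comment> \<open>Five points are needed to cut off \<open>p1\<close>, ..., \<open>p4\<close>
      and keep \<open>a\<close>.\<close>
    have "(2::nat) ^ 3 \<le> 2 ^ (n - 2)"
      using 4 by (intro power_increasing) auto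
    then have "length xs \<ge> 5"
      using distinct_card[OF xs(2)] xs(3) by simp
    then obtain p1 p2 p3 p4 a zs where "xs = p1 # p2 # p3 # p4 # a # zs"
      by (auto simp: numeral_eq_Suc Suc_le_length_iff)
    moreover have "n - 2 + 2 = n" "n - 2 \<ge> 3"
      using 4 by linarith+
    ultimately show ?thesis
      using loose_path_extend[of p1 p2 p3 p4 a zs "n - 2"] xs by (simp only:)
  qed
qed

theorem mainTheorem1:
  fixes n :: nat
  assumes "n \<ge> 2"
  shows "sequentially_ternary n \<longleftrightarrow> n \<notin> {3, 4}"
proof
  assume "sequentially_ternary n"
  then show "n \<notin> {3, 4}"
    using not_xor_ternary_3 not_xor_ternary_4
    by (auto simp: sequentially_ternary_iff_xor_ternary)
next
  assume "n \<notin> {3, 4}"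
  then have "n = 2 \<or> n \<ge> 5"
    using assms by auto
  then obtain xs where "loose_path xs" "distinct xs" "set xs = {1..<2 ^ n}"
    using ex_loose_path by blast
  then show "sequentially_ternary n"
    unfolding sequentially_ternary_iff_xor_ternary using xor_ternary_loose_path by blast
qed

end
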